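(* Let $\mathbb{Z}[i]\setminus\{0\}$ be equipped with the coprimality topology $\mathcal{T}$. For all $x,y\in\mathbb{Z}[i]\setminus\{0\}$, $$y\in\overline{\{x\}}\quad\Longleftrightarrow\quad \operatorname{Supp}(x)\subseteq\operatorname{Supp}(y),$$ where $\overline{\{x\}}$ denotes the closure of $\{x\}$ with respect to $\mathcal{T}$.
   Context: $\mathbb{Z}[i]$ is the ring of Gaussian integers, with group of units $\{1,-1,i,-i\}$. Two elements $\alpha,\beta\in\mathbb{Z}[i]\setminus\{0\}$ are associates, written $\alpha\sim\beta$, if $\alpha=u\beta$ for some unit $u$; $\gcd(\alpha,\beta)\sim 1$ means that $\alpha$ and $\beta$ are coprime. For $\alpha\in\mathbb{Z}[i]\setminus\{0\}$, the prime support $\operatorname{Supp}(\alpha)$ is the finite set of associate classes of Gaussian primes dividing $\alpha$ (so it is empty if $\alpha$ is a unit). For $\alpha\in\mathbb{Z}[i]\setminus\{0\}$ put $\sigma_\alpha=\{\beta\in\mathbb{Z}[i]\setminus\{0\}:\gcd(\alpha,\beta)\sim 1\}$. The coprimality topology $\mathcal{T}$ on $\mathbb{Z}[i]\setminus\{0\}$ is the topology generated by the collection $\{\sigma_\alpha:\alpha\in\mathbb{Z}[i]\setminus\{0\}\}$. *)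

theory Defs
  imports
    "HOL-Analysis.Abstract_Topology"
    "HOL-Analysis.Complex_Transcendental"
    "HOL-Computational_Algebra.Factorial_Ring"
begin

typedef gauss_int = "{z :: complex. Re z \<in> \<int> \<and> Im z \<in> \<int>}"
  by (rule exI[of _ 0]) simp

setup_lifting type_definition_gauss_int

text \<open>
  Division is exact division, with value 0 wherever the quotient is not a Gaussian integer. It is
  here only because the class of the library constant \<^term>\<open>coprime\<close> requires such an operation;
  divisibility does not depend on it.
\<close>

instantiation gauss_int :: idom_divide
begin

lift_definition zero_gauss_int :: gauss_int is 0 by simp
lift_definition one_gauss_int :: gauss_int is 1 by simp
lift_definition plus_gauss_int :: "gauss_int \<Rightarrow> gauss_int \<Rightarrow> gauss_int" is "(+)" by simp
lift_definition minus_gauss_int :: "gauss_int \<Rightarrow> gauss_int \<Rightarrow> gauss_int" is "(-)" by simp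
lift_definition uminus_gauss_int :: "gauss_int \<Rightarrow> gauss_int" is uminus by simp
lift_definition times_gauss_int :: "gauss_int \<Rightarrow> gauss_int \<Rightarrow> gauss_int" is "(*)" by simp
lift_definition divide_gauss_int :: "gauss_int \<Rightarrow> gauss_int \<Rightarrow> gauss_int" is
  "\<lambda>z w. if Re (z / w) \<in> \<int> \<and> Im (z / w) \<in> \<int> then z / w else 0"
  by simp

instance
  by standard (transfer; simp add: algebra_simps; fail)+

end

instance gauss_int :: algebraic_semidom ..

lift_definition gauss_i :: gauss_int is \<i> by simp

lemma gauss_int_units: "{u :: gauss_int. is_unit u} = {1, -1, gauss_i, - gauss_i}"
proof (intro equalityI subsetI)
  fix u :: gauss_int
  assume "u \<in> {u. is_unit u}"
  hence u: "is_unit u" by simp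
  obtain v where uv: "1 = u * v" using u by (elim dvdE)
  from uv have "Rep_gauss_int u * Rep_gauss_int v = 1" by (metis one_gauss_int.rep_eq times_gauss_int.rep_eq)
  moreover obtain a b where u': "Rep_gauss_int u = Complex (of_int a) (of_int b)"
    using Rep_gauss_int[of u] by (auto simp: complex_eq_iff elim!: Ints_cases)
  moreover obtain c d where v': "Rep_gauss_int v = Complex (of_int c) (of_int d)"
    using Rep_gauss_int[of v] by (auto simp: complex_eq_iff elim!: Ints_cases)
  ultimately have "(cmod (Complex (of_int a) (of_int b)))\<^sup>2 * (cmod (Complex (of_int c) (of_int d)))\<^sup>2 = 1"
    by (metis norm_mult norm_one power_mult_distrib power_one)
  hence "real_of_int ((a\<^sup>2 + b\<^sup>2) * (c\<^sup>2 + d\<^sup>2)) = real_of_int 1"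
    by (simp add: cmod_power2)
  hence "(a\<^sup>2 + b\<^sup>2) * (c\<^sup>2 + d\<^sup>2) = 1" by (simp only: of_int_eq_iff)
  moreover have "0 \<le> a\<^sup>2 + b\<^sup>2" by simp
  ultimately have n: "a\<^sup>2 + b\<^sup>2 = 1"
    unfolding zmult_eq_1_iff by linarith
  have "a\<^sup>2 \<le> 1" "b\<^sup>2 \<le> 1"
    using n zero_le_power2[of a] zero_le_power2[of b] by linarith+
  hence "\<bar>a\<bar> \<le> 1" "\<bar>b\<bar> \<le> 1" by (simp_all only: abs_square_le_1)
  hence "a \<in> {-1,0,1}" "b \<in> {-1,0,1}" by auto
  hence "Rep_gauss_int u \<in> {1, -1, \<i>, -\<i>}" using n u'
    by (auto simp: complex_eq_iff)
  thus "u \<in> {1, -1, gauss_i, - gauss_i}"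
    by (simp flip: one_gauss_int.rep_eq gauss_i.rep_eq uminus_gauss_int.rep_eq add: Rep_gauss_int_inject)
next
  fix u :: gauss_int
  assume u: "u \<in> {1, -1, gauss_i, - gauss_i}"
  have "1 = gauss_i * - gauss_i" by transfer simp
  hence "is_unit gauss_i" by (rule dvdI)
  with u show "u \<in> {u. is_unit u}" by auto
qed

definition gauss_assoc :: "gauss_int \<Rightarrow> gauss_int \<Rightarrow> bool" where
  "gauss_assoc a b \<longleftrightarrow> a \<noteq> 0 \<and> b \<noteq> 0 \<and> (\<exists>u. is_unit u \<and> a = u * b)"

definition assoc_class :: "gauss_int \<Rightarrow> gauss_int set" where
  "assoc_class a = {b. gauss_assoc b a}"

definition prime_supp :: "gauss_int \<Rightarrow> gauss_int set set" where
  "prime_supp a = {assoc_class p | p. prime_elem p \<and> p dvd a}"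

definition coprime_set :: "gauss_int \<Rightarrow> gauss_int set" where
  "coprime_set a = {b. b \<noteq> 0 \<and> coprime a b}"

definition coprimality_topology :: "gauss_int topology" where
  "coprimality_topology = topology_generated_by {coprime_set a | a. a \<noteq> 0}"

lemma topspace_coprimality_topology: "topspace coprimality_topology = {a. a \<noteq> 0}"
proof -
  have "coprime_set 1 = {a. a \<noteq> 0}" by (auto simp: coprime_set_def)
  hence "{a. a \<noteq> 0} \<in> {coprime_set a | a. a \<noteq> 0}"
    by (metis (mono_tags, lifting) mem_Collect_eq zero_neq_one)
  moreover have "coprime_set a \<subseteq> {a. a \<noteq> 0}" for a by (auto simp: coprime_set_def)
  ultimately show ?thesis
    unfolding coprimality_topology_def topology_generated_by_topspace by blast
qed

end

theory Submission
  imports Defs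
begin

text \<open>
  The point \<open>y\<close> lies in the closure of \<open>{x}\<close> iff every open set containing \<open>y\<close> contains \<open>x\<close>, and
  it suffices to test this on the subbasis: every \<open>a\<close> coprime to \<open>y\<close> must be coprime to \<open>x\<close>.
  If this holds and a prime \<open>p\<close> divides \<open>x\<close>, then \<open>p\<close> is not coprime to \<open>x\<close>, hence not to \<open>y\<close>, and
  a prime that is not coprime to \<open>y\<close> divides \<open>y\<close>. Conversely, if \<open>a\<close> is not coprime to \<open>x\<close>, then some
  prime divides both; as the support of \<open>x\<close> lies in that of \<open>y\<close>, this prime divides \<open>y\<close> too, so \<open>a\<close>
  is not coprime to \<open>y\<close>.

  The arithmetic input is in the converse: two Gaussian integers that are not coprime share a
  \<^emph>\<open>prime\<close> and not merely a non-unit (\<open>prime_elem_divisor_exists\<close>). This is derived directly from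
  division with remainder (\<open>gauss_division\<close>).
\<close>

text \<open>
  The property of containing \<open>x\<close> whenever one contains \<open>y\<close> is preserved by finite intersections and
  arbitrary unions, so it passes from the subbasis to all open sets.
\<close>

lemma in_closure_of_singleton_generated_by:
  assumes "x \<in> \<Union>S" and "y \<in> \<Union>S"
  shows "y \<in> topology_generated_by S closure_of {x} \<longleftrightarrow> (\<forall>U\<in>S. y \<in> U \<longrightarrow> x \<in> U)"
proof
  assume "y \<in> topology_generated_by S closure_of {x}"
  thus "\<forall>U\<in>S. y \<in> U \<longrightarrow> x \<in> U"
    by (auto simp: in_closure_of intro: topology_generated_by_Basis)
next
  assume *: "\<forall>U\<in>S. y \<in> U \<longrightarrow> x \<in> U"
  have "y \<in> U \<longrightarrow> x \<in> U" if "generate_topology_on S U" for U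
    using that * by induction auto
  thus "y \<in> topology_generated_by S closure_of {x}"
    using assms
    by (auto simp: in_closure_of openin_topology_generated_by_iff)
qed

text \<open>
  The norm takes values in \<^typ>\<open>nat\<close> so that elements of least norm exist in every nonempty set.
\<close>

definition gauss_norm :: "gauss_int \<Rightarrow> nat" where
  "gauss_norm a = nat \<lfloor>(cmod (Rep_gauss_int a))\<^sup>2\<rfloor>"

lemma of_nat_gauss_norm: "real (gauss_norm a) = (cmod (Rep_gauss_int a))\<^sup>2"
proof -
  have "(Re (Rep_gauss_int a))\<^sup>2 + (Im (Rep_gauss_int a))\<^sup>2 \<in> \<int>"
    using Rep_gauss_int[of a] by auto
  hence "(cmod (Rep_gauss_int a))\<^sup>2 \<in> \<int>"
    by (simp add: cmod_power2)
  thus ?thesis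
    unfolding gauss_norm_def by (auto elim!: Ints_cases)
qed

lemma gauss_norm_mult: "gauss_norm (a * b) = gauss_norm a * gauss_norm b"
proof -
  have "real (gauss_norm (a * b)) = real (gauss_norm a * gauss_norm b)"
    by (simp add: of_nat_gauss_norm times_gauss_int.rep_eq norm_mult power_mult_distrib)
  thus ?thesis by (simp only: of_nat_eq_iff)
qed

lemma gauss_norm_eq_0_iff: "gauss_norm a = 0 \<longleftrightarrow> a = 0"
proof -
  have "gauss_norm a = 0 \<longleftrightarrow> real (gauss_norm a) = 0" by simp
  also have "\<dots> \<longleftrightarrow> Rep_gauss_int a = Rep_gauss_int 0"
    by (simp add: of_nat_gauss_norm zero_gauss_int.rep_eq del: of_nat_eq_0_iff)
  finally show ?thesis by (simp add: Rep_gauss_int_inject)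
qed

text \<open>
  The nearest lattice point to \<open>a / b\<close> is at distance at most \<open>1 / 2\<close> in each coordinate, hence at
  squared distance at most \<open>1 / 2 < 1\<close>.
\<close>

lemma gauss_division:
  assumes "b \<noteq> 0"
  shows "\<exists>q. gauss_norm (a - q * b) < gauss_norm b"
proof -
  define w z where "w = Rep_gauss_int b" and "z = Rep_gauss_int a / w"
  define c where "c = Complex (of_int (round (Re z))) (of_int (round (Im z)))"
  define q where "q = Abs_gauss_int c"
  have w: "w \<noteq> 0"
    using assms unfolding w_def by (metis Rep_gauss_int_inject zero_gauss_int.rep_eq)
  have q: "Rep_gauss_int q = c"
    unfolding q_def by (rule Abs_gauss_int_inverse) (simp add: c_def)
  have half: "(t - of_int (round t))\<^sup>2 \<le> 1 / 4" for t :: real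
  proof -
    have "\<bar>t - of_int (round t)\<bar> \<le> 1 / 2"
      using of_int_round_abs_le[of t] by (simp add: abs_minus_commute)
    hence "\<bar>t - of_int (round t)\<bar>\<^sup>2 \<le> (1 / 2)\<^sup>2" by (intro power_mono) auto
    thus ?thesis by (simp add: power2_eq_square)
  qed
  have "(cmod (z - c))\<^sup>2 < 1"
    using half[of "Re z"] half[of "Im z"] by (simp add: cmod_power2 c_def)
  moreover have "Rep_gauss_int (a - q * b) = (z - c) * w"
    using w by (simp add: minus_gauss_int.rep_eq times_gauss_int.rep_eq q z_def field_simps flip: w_def)
  ultimately have "real (gauss_norm (a - q * b)) < real (gauss_norm b)"
    using w by (simp add: of_nat_gauss_norm norm_mult power_mult_distrib flip: w_def)
  thus ?thesis by auto
qed

lemma gauss_norm_eq_1_imp_is_unit: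
  assumes "gauss_norm a = 1"
  shows "is_unit a"
proof -
  have "a \<noteq> 0" using assms gauss_norm_eq_0_iff[of a] by auto
  then obtain q where "gauss_norm (1 - q * a) < gauss_norm a"
    using gauss_division by blast
  hence "1 - q * a = 0" using assms by (simp flip: gauss_norm_eq_0_iff)
  hence "1 = a * q" by (simp add: mult.commute)
  thus ?thesis by (rule dvdI)
qed

text \<open>
  A divisor \<open>p\<close> of \<open>d\<close> that has least norm among the non-unit divisors is prime. For let \<open>p\<close> divide
  \<open>a * b\<close>. The ideal of all \<open>z\<close> with \<open>p dvd z * b\<close> contains \<open>p\<close> and \<open>a\<close>, and division with remainder
  makes it principal, generated by some \<open>g\<close>. In \<open>p = g * h\<close> minimality forces \<open>g\<close> or \<open>h\<close> to be a
  unit: if \<open>g\<close> is, then \<open>p dvd b\<close>; if \<open>h\<close> is, then \<open>p dvd g\<close> and so \<open>p dvd a\<close>.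
\<close>

lemma prime_elem_divisor_exists:
  fixes d :: gauss_int
  assumes "d \<noteq> 0" and "\<not> is_unit d"
  shows "\<exists>p. prime_elem p \<and> p dvd d"
proof -
  obtain p where p: "p dvd d" "\<not> is_unit p"
    and p_min: "\<And>c. c dvd d \<Longrightarrow> \<not> is_unit c \<Longrightarrow> gauss_norm p \<le> gauss_norm c"
    using ex_has_least_nat[of "\<lambda>c. c dvd d \<and> \<not> is_unit c" d gauss_norm] assms
    by auto
  have p0: "p \<noteq> 0" using p(1) assms(1) by auto
  have "p dvd a \<or> p dvd b" if ab: "p dvd a * b" for a b
  proof -
    obtain g where g: "g \<noteq> 0" "p dvd g * b"
      and g_min: "\<And>z. z \<noteq> 0 \<Longrightarrow> p dvd z * b \<Longrightarrow> gauss_norm g \<le> gauss_norm z"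
      using ex_has_least_nat[of "\<lambda>z. z \<noteq> 0 \<and> p dvd z * b" p gauss_norm] p0 by auto
    have g_dvd: "g dvd z" if z: "p dvd z * b" for z
    proof -
      obtain q where q: "gauss_norm (z - q * g) < gauss_norm g"
        using gauss_division g(1) by blast
      have "(z - q * g) * b = z * b - q * (g * b)" by (simp add: algebra_simps)
      hence "p dvd (z - q * g) * b" using z g(2) by (metis dvd_diff dvd_mult)
      hence "z - q * g = 0" using g_min q by (meson not_le)
      thus ?thesis by simp
    qed
    from g_dvd[of p] obtain h where h: "p = g * h" by (auto elim: dvdE)
    show ?thesis
    proof (cases "is_unit h")
      case True
      hence "p dvd g" using h by simp
      thus ?thesis using g_dvd[OF ab] dvd_trans by blast
    next
      case False
      have "h dvd d" using h p(1) by (metis dvd_mult_right)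
      hence "gauss_norm g * gauss_norm h \<le> 1 * gauss_norm h"
        using p_min False h by (simp add: gauss_norm_mult)
      moreover have "gauss_norm h \<noteq> 0" using h p0 by (auto simp: gauss_norm_eq_0_iff)
      ultimately have "gauss_norm g = 1"
        using g(1) by (simp add: gauss_norm_eq_0_iff le_Suc_eq)
      hence "is_unit g" by (rule gauss_norm_eq_1_imp_is_unit)
      thus ?thesis using g(2) by (simp add: dvd_mult_unit_iff')
    qed
  qed
  hence "prime_elem p" using p0 p(2) by (intro prime_elemI)
  thus ?thesis using p(1) by blast
qed

lemma assoc_class_in_prime_supp_iff:
  assumes "prime_elem p"
  shows "assoc_class p \<in> prime_supp a \<longleftrightarrow> p dvd a"
proof
  assume "assoc_class p \<in> prime_supp a"
  then obtain q where q: "assoc_class p = assoc_class q" "q dvd a"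
    by (auto simp: prime_supp_def)
  have "p \<in> assoc_class p"
    using assms by (auto simp: assoc_class_def gauss_assoc_def intro!: exI[of _ 1])
  hence "\<exists>u. is_unit u \<and> p = u * q"
    unfolding q(1) by (simp add: assoc_class_def gauss_assoc_def)
  thus "p dvd a" using q(2) by (auto simp: mult_unit_dvd_iff')
qed (use assms in \<open>auto simp: prime_supp_def\<close>)

lemma prime_supp_subset_iff:
  "prime_supp x \<subseteq> prime_supp y \<longleftrightarrow> (\<forall>p. prime_elem p \<longrightarrow> p dvd x \<longrightarrow> p dvd y)"
proof
  assume "prime_supp x \<subseteq> prime_supp y"
  thus "\<forall>p. prime_elem p \<longrightarrow> p dvd x \<longrightarrow> p dvd y"
    by (meson assoc_class_in_prime_supp_iff subsetD)
qed (auto simp: prime_supp_def)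

lemma not_coprime_imp_common_prime_elem:
  fixes a b :: gauss_int
  assumes "\<not> coprime a b" and "a \<noteq> 0"
  shows "\<exists>p. prime_elem p \<and> p dvd a \<and> p dvd b"
proof -
  obtain d where d: "d dvd a" "d dvd b" "\<not> is_unit d"
    using assms(1) by (rule not_coprimeE)
  hence "d \<noteq> 0" using assms(2) by auto
  with d show ?thesis using prime_elem_divisor_exists dvd_trans by meson
qed

lemma not_coprime_prime_elem_imp_dvd:
  fixes p a :: "'a :: algebraic_semidom"
  assumes "prime_elem p" and "\<not> coprime p a"
  shows "p dvd a"
proof -
  obtain d where d: "d dvd p" "d dvd a" "\<not> is_unit d"
    using assms(2) by (rule not_coprimeE)
  have "irreducible p" using assms(1) by (rule prime_elem_imp_irreducible)
  hence "p dvd d" using irreducibleD' d(1,3) by blast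
  thus ?thesis using d(2) by (rule dvd_trans)
qed

theorem proposition3p4:
  fixes x y :: gauss_int
  assumes "x \<noteq> 0" and "y \<noteq> 0"
  shows "y \<in> coprimality_topology closure_of {x} \<longleftrightarrow> prime_supp x \<subseteq> prime_supp y"
proof -
  have union: "\<Union>{coprime_set a | a. a \<noteq> 0} = {a. a \<noteq> 0}"
    using topspace_coprimality_topology
    unfolding coprimality_topology_def topology_generated_by_topspace .
  have "y \<in> coprimality_topology closure_of {x} \<longleftrightarrow>
      (\<forall>U\<in>{coprime_set a | a. a \<noteq> 0}. y \<in> U \<longrightarrow> x \<in> U)"
    unfolding coprimality_topology_def
    by (rule in_closure_of_singleton_generated_by; unfold union; use assms in simp)
  also have "\<dots> \<longleftrightarrow> (\<forall>a. a \<noteq> 0 \<longrightarrow> coprime a y \<longrightarrow> coprime a x)"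
    using assms by (auto simp: coprime_set_def)
  also have "\<dots> \<longleftrightarrow> (\<forall>p. prime_elem p \<longrightarrow> p dvd x \<longrightarrow> p dvd y)"
  proof (intro iffI allI impI)
    fix p
    assume *: "\<forall>a. a \<noteq> 0 \<longrightarrow> coprime a y \<longrightarrow> coprime a x"
      and p: "prime_elem p" "p dvd x"
    have "\<not> coprime p x"
      using p coprime_common_divisor[of p x p] by auto
    hence "\<not> coprime p y" using * p(1) by auto
    thus "p dvd y" using not_coprime_prime_elem_imp_dvd p(1) by blast
  next
    fix a
    assume *: "\<forall>p. prime_elem p \<longrightarrow> p dvd x \<longrightarrow> p dvd y" and a: "a \<noteq> 0" "coprime a y"
    show "coprime a x"
    proof (rule ccontr)
      assume "\<not> coprime a x"
      then obtain p where p: "prime_elem p" "p dvd a" "p dvd x"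
        using not_coprime_imp_common_prime_elem a(1) by blast
      hence "is_unit p" using * a(2) coprime_common_divisor by blast
      thus False using p(1) by simp
    qed
  qed
  also have "\<dots> \<longleftrightarrow> prime_supp x \<subseteq> prime_supp y"
    by (rule prime_supp_subset_iff[symmetric])
  finally show ?thesis .
qed

end
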